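(* Let $q$ be a prime power, let $n\ge 1$ and $t\ge 2$ be integers, let $A$ be a Hermitian $n\times n$ matrix over $\mathbb{F}_{q^2}$ (i.e. $\overline{A}^T=A$), and let $\lambda_1,\dots,\lambda_n$ be the eigenvalues of $A$. Let $f_1,\dots,f_{t-1}\in\mathbb{F}_{q}[x]$ and let $C$ be the linear code over $\mathbb{F}_{q^2}$ with generator matrix $(I_n\ f_1(A)\ f_2(A)\ \cdots\ f_{t-1}(A))$. Then: (1) Assume $\operatorname{char}\mathbb{F}_q$ is even. If there is a unique index $i$ ($1\le i\le n$) such that $f_1(\lambda_i)+f_2(\lambda_i)+\cdots+f_{t-1}(\lambda_i)=1$, then $C$ is a linear $[tn,n]$ code with one-dimensional Hermitian hull. (2) Assume $\operatorname{char}\mathbb{F}_q$ is odd. If there is a unique index $i$ ($1\le i\le n$) such that $f_1(\lambda_i)^2+f_2(\lambda_i)^2+\cdots+f_{t-1}(\lambda_i)^2=-1$, then $C$ is a linear $[tn,n]$ code with one-dimensional Hermitian hull. In particular, when $t=2$, if there is a unique index $i$ ($1\le i\le n$) such that $f_1(\lambda_i)\in\{\mu,-\mu\}$, where $\mu\in\mathbb{F}_{q^2}$ satisfies $\mu^2=-1$, then $C$ is a linear $[2n,n]$ code with one-dimensional Hermitian hull.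
   Context: $I_n$ is the $n\times n$ identity matrix. For $x\in\mathbb{F}_{q^2}$ write $\overline{x}=x^q$, and for a matrix $A=(a_{ij})$ write $\overline{A}=(\overline{a_{ij}})$. Eigenvalues are taken in an algebraic closure of $\mathbb{F}_{q^2}$ and listed with algebraic multiplicity (so uniqueness of the index $i$ counts multiplicity). An $[N,K]$ linear code over $\mathbb{F}_{q^2}$ is a $K$-dimensional subspace $C$ of $\mathbb{F}_{q^2}^N$. Its Hermitian dual is $C^{\perp_H}=\{y\in\mathbb{F}_{q^2}^N:\sum_{i=1}^N x_i\overline{y_i}=0 \text{ for all } x\in C\}$ and its Hermitian hull is $C\cap C^{\perp_H}$. The code with generator matrix $G$ is the row space of $G$. *)

theory Defs
  imports
    "Jordan_Normal_Form.Char_Poly"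
    "Jordan_Normal_Form.VS_Connect"
    "HOL-Algebra.Algebraic_Closure_Type"
    "HOL-Number_Theory.Prime_Powers"
    "HOL-Number_Theory.Residues"
    "HOL-Library.Cardinality"
begin

text \<open>
  Throughout, the type \<^typ>\<open>'a\<close> plays the role of the field with $q^2$ elements; this is
  imposed in the theorem by \<open>CARD('a) = q\<^sup>2\<close>. Its subfield with $q$ elements is the fixed field
  of $x \mapsto x^q$; \<open>card_Fq\<close> and \<open>Fq_subfield\<close> below confirm that this set is a subfield
  of the right size.
\<close>

definition Fq :: "nat \<Rightarrow> 'a :: field set" where
  "Fq q = {x. x ^ q = x}"

definition bar_vec :: "nat \<Rightarrow> 'a :: field vec \<Rightarrow> 'a vec" where
  "bar_vec q v = map_vec (\<lambda>x. x ^ q) v"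

definition bar_mat :: "nat \<Rightarrow> 'a :: field mat \<Rightarrow> 'a mat" where
  "bar_mat q A = map_mat (\<lambda>x. x ^ q) A"

definition hermitian_mat :: "nat \<Rightarrow> 'a :: field mat \<Rightarrow> bool" where
  "hermitian_mat q A \<longleftrightarrow> transpose_mat (bar_mat q A) = A"

text \<open>
  \<open>lam 1, \<dots>, lam n\<close> are the eigenvalues of \<open>A\<close> in the algebraic closure, each listed as often
  as its algebraic multiplicity; values of \<open>lam\<close> outside \<open>{1..n}\<close> are irrelevant.
\<close>

definition eigenvalues_listed :: "nat \<Rightarrow> 'a :: field mat \<Rightarrow> (nat \<Rightarrow> 'a alg_closure) \<Rightarrow> bool" where
  "eigenvalues_listed n A lam \<longleftrightarrow>
     image_mset lam (mset_set {1..n}) = proots (char_poly (map_mat to_ac A))"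

definition poly_ac :: "'a :: field poly \<Rightarrow> 'a alg_closure \<Rightarrow> 'a alg_closure" where
  "poly_ac p x = poly (map_poly to_ac p) x"

text \<open>The square matrix \<open>p(A)\<close>; matrices of a given size do not form a type, so the sum of the
  \<open>coeff p k \<cdot> A\<^sup>k\<close> is taken entrywise.\<close>

definition mat_poly :: "'a :: field poly \<Rightarrow> 'a mat \<Rightarrow> 'a mat" where
  "mat_poly p A = mat (dim_row A) (dim_row A)
     (\<lambda>(i, j). \<Sum>k\<le>Polynomial.degree p. Polynomial.coeff p k * (A ^\<^sub>m k) $$ (i, j))"

text \<open>Horizontal concatenation of \<open>n \<times> n\<close> blocks: entry \<open>(i, j)\<close> lies in block \<open>j div n\<close>.\<close>

definition block_row :: "nat \<Rightarrow> 'a mat list \<Rightarrow> 'a mat" where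
  "block_row n Bs = mat n (length Bs * n) (\<lambda>(i, j). (Bs ! (j div n)) $$ (i, j mod n))"

definition gen_mat :: "nat \<Rightarrow> nat \<Rightarrow> (nat \<Rightarrow> 'a :: field poly) \<Rightarrow> 'a mat \<Rightarrow> 'a mat" where
  "gen_mat n t f A = block_row n (1\<^sub>m n # map (\<lambda>k. mat_poly (f k) A) [1..<t])"

definition code_of :: "'a :: field mat \<Rightarrow> 'a vec set" where
  "code_of G = vec_space.row_space (dim_col G) G"

definition code_dim :: "nat \<Rightarrow> 'a :: field vec set \<Rightarrow> nat" where
  "code_dim N C = vectorspace.dim class_ring (module_vec TYPE('a) N \<lparr>carrier := C\<rparr>)"

definition linear_code :: "nat \<Rightarrow> nat \<Rightarrow> 'a :: field vec set \<Rightarrow> bool" where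
  "linear_code N K C \<longleftrightarrow>
     VectorSpace.subspace class_ring C (module_vec TYPE('a) N) \<and> code_dim N C = K"

definition hermitian_dual :: "nat \<Rightarrow> nat \<Rightarrow> 'a :: field vec set \<Rightarrow> 'a vec set" where
  "hermitian_dual q N C = {y \<in> carrier_vec N. \<forall>x\<in>C. x \<bullet> bar_vec q y = 0}"

definition hermitian_hull :: "nat \<Rightarrow> nat \<Rightarrow> 'a :: field vec set \<Rightarrow> 'a vec set" where
  "hermitian_hull q N C = C \<inter> hermitian_dual q N C"

lemma frobenius_add:
  fixes x y :: "'a :: finite_field"
  assumes "primepow q" "CARD('a) = q\<^sup>2"
  shows "(x + y) ^ q = x ^ q + y ^ q"
proof -
  from assms(1) obtain p k where p: "Factorial_Ring.prime p" "k > 0" "q = p ^ k"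
    unfolding primepow_def by auto
  have pr: "Factorial_Ring.prime CHAR('a)" by (rule prime_CHAR_semidom) simp
  have "CHAR('a) dvd q\<^sup>2" using CHAR_dvd_CARD[where ?'a = 'a] assms(2) by simp
  hence "CHAR('a) dvd p"
    using pr p by (metis prime_dvd_power)
  hence "CHAR('a) = p" using pr p(1) primes_dvd_imp_eq by blast
  thus ?thesis using freshmans_dream'[of q k x y] p pr by simp
qed

lemma Fq_subfield:
  fixes x y :: "'a :: finite_field"
  assumes "primepow q" "CARD('a) = q\<^sup>2"
  shows "(0 :: 'a) \<in> Fq q" "(1 :: 'a) \<in> Fq q"
    and "x \<in> Fq q \<Longrightarrow> y \<in> Fq q \<Longrightarrow> x + y \<in> Fq q"
    and "x \<in> Fq q \<Longrightarrow> y \<in> Fq q \<Longrightarrow> x * y \<in> Fq q"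
    and "x \<in> Fq q \<Longrightarrow> - x \<in> Fq q"
    and "x \<in> Fq q \<Longrightarrow> inverse x \<in> Fq q"
proof -
  have q: "q > 0" using assms(1) by (simp add: primepow_gt_0_nat)
  show "(0 :: 'a) \<in> Fq q" "(1 :: 'a) \<in> Fq q" using q by (auto simp: Fq_def)
  show "x \<in> Fq q \<Longrightarrow> y \<in> Fq q \<Longrightarrow> x + y \<in> Fq q"
    by (simp add: Fq_def frobenius_add[OF assms])
  show "x \<in> Fq q \<Longrightarrow> y \<in> Fq q \<Longrightarrow> x * y \<in> Fq q"
    by (simp add: Fq_def power_mult_distrib)
  have "x ^ q + (- x) ^ q = 0" using frobenius_add[OF assms, of x "- x"] q by (simp add: zero_power)
  thus "x \<in> Fq q \<Longrightarrow> - x \<in> Fq q"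
    by (simp add: Fq_def) (metis neg_eq_iff_add_eq_0)
  show "x \<in> Fq q \<Longrightarrow> inverse x \<in> Fq q"
    by (simp add: Fq_def power_inverse)
qed

lemma card_Fq:
  assumes "primepow q" "CARD('a :: finite_field) = q\<^sup>2"
  shows "card (Fq q :: 'a set) = q"
proof -
  have q1: "q > 1" using assms(1) by (rule primepow_gt_Suc_0[unfolded One_nat_def[symmetric]])
  have bound: "card {x :: 'a. x ^ q = c * x} \<le> q" for c
  proof -
    let ?p = "Polynomial.monom 1 q - Polynomial.monom c 1 :: 'a poly"
    have d: "Polynomial.degree ?p \<le> q"
      by (rule degree_diff_le) (use q1 degree_monom_le[of c 1] in \<open>auto simp: degree_monom_eq\<close>)
    have "Polynomial.coeff ?p q = 1" using q1 by simp
    hence "?p \<noteq> 0" by (metis Polynomial.coeff_0 zero_neq_one)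
    hence "card {x. poly ?p x = 0} \<le> Polynomial.degree ?p" by (rule poly_roots_degree)
    moreover have "{x. poly ?p x = 0} = {x. x ^ q = c * x}" by (auto simp: poly_monom)
    ultimately show ?thesis using d by simp
  qed
  define h where "h = (\<lambda>x :: 'a. x ^ q - x)"
  have dif: "(x - y) ^ q = x ^ q - y ^ q" for x y :: 'a
    using frobenius_add[OF assms, of "x - y" y] by (simp add: algebra_simps)
  have "range h \<subseteq> {x. x ^ q = (- 1) * x}"
  proof
    fix y assume "y \<in> range h"
    then obtain x where y: "y = x ^ q - x" by (auto simp: h_def)
    have "(x ^ q) ^ q = x"
      using finite_field_power_card_eq_same[of x] assms(2)
      by (simp add: power2_eq_square power_mult)
    thus "y \<in> {x. x ^ q = (- 1) * x}" by (simp add: y dif)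
  qed
  hence r: "card (range h) \<le> q" using bound[of "- 1"] by (meson card_mono finite le_trans)
  define g where "g = (\<lambda>x. (h x, x - inv_into UNIV h (h x)))"
  have "inj g" by (auto simp: inj_def g_def)
  moreover have "g ` UNIV \<subseteq> range h \<times> Fq q"
  proof (clarsimp simp: g_def)
    fix x
    have "h (inv_into UNIV h (h x)) = h x" by (simp add: f_inv_into_f)
    thus "x - inv_into UNIV h (h x) \<in> Fq q" by (simp add: h_def Fq_def dif algebra_simps)
  qed
  ultimately have "CARD('a) \<le> card (range h \<times> (Fq q :: 'a set))"
    by (intro card_inj_on_le) auto
  hence "q * q \<le> card (range h) * card (Fq q :: 'a set)"
    using assms(2) by (simp add: power2_eq_square card_cartesian_product)
  also have "\<dots> \<le> q * card (Fq q :: 'a set)" using r by simp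
  finally have "q \<le> card (Fq q :: 'a set)" using q1 by simp
  moreover have "card (Fq q :: 'a set) \<le> q" using bound[of 1] by (simp add: Fq_def)
  ultimately show ?thesis by simp
qed

end

theory Submission
  imports Defs "Jordan_Normal_Form.Column_Operations"
begin

text \<open>
  Write $G$ for the generator matrix. Since \<open>A\<close> is Hermitian and the \<open>f k\<close> have coefficients in
  $\mathbb{F}_q$, every block \<open>f k (A)\<close> is Hermitian, so $G \overline{G}^T = p(A)$ with
  $p = 1 + \sum_k f_k^2$, and the hull consists of the $G^T x$ with $p(A)\,\overline{x} = 0$.
  Exactly one listed eigenvalue $\theta$ is a root of $p$; it is therefore a simple root of the
  characteristic polynomial and the only root it shares with $p$. Over the algebraic closure
  this makes the kernel of $p(A)$ the eigenline of $\theta$, and the dimension of a kernel does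
  not change under field extension.
  In characteristic two $p = (1 + \sum_k f_k)^2$.
\<close>

(* Otherwise v $ i is ambiguous between vectors and power series. *)
no_notation fps_nth (infixl \<open>$\<close> 75)

subsection \<open>Kernels at a simple eigenvalue\<close>

lemma det_replace_col_smult:
  fixes A :: "'a :: comm_ring_1 mat"
  assumes A: "A \<in> carrier_mat n n" and b: "b \<in> carrier_vec n" and k: "k < n"
  shows "det (replace_col A (c \<cdot>\<^sub>v b) k) = c * det (replace_col A b k)"
proof -
  have Ab: "replace_col A b k \<in> carrier_mat n n"
    using A by (auto simp: replace_col_def)
  have "replace_col A (c \<cdot>\<^sub>v b) k = multcol k c (replace_col A b k)"
    by (rule eq_matI) (use A b in \<open>auto simp: replace_col_def\<close>)
  \<comment> \<open>Multiplied from the right, the elementary matrix that scales row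
    \<open>k\<close> scales column \<open>k\<close>; its determinant is \<open>c\<close>.\<close>
  also have "\<dots> = replace_col A b k * multrow_mat n k c"
    by (rule multcol_mat[OF Ab])
  finally show ?thesis
    using k by (simp add: det_mult[OF Ab, of "multrow_mat n k c"] det_multrow_mat mult.commute)
qed

text \<open>A division-free form of Cramer's rule: it is applied below to polynomial matrices, whose
  determinants need not be units.\<close>

lemma adj_mat_mult_vec:
  fixes A :: "'a :: comm_ring_1 mat"
  assumes A: "A \<in> carrier_mat n n" and x: "x \<in> carrier_vec n"
  shows "adj_mat A *\<^sub>v (A *\<^sub>v x) = det A \<cdot>\<^sub>v x"
proof -
  have "adj_mat A *\<^sub>v (A *\<^sub>v x) = (adj_mat A * A) *\<^sub>v x"
    using adj_mat(1)[OF A] A x by simp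
  also have "\<dots> = det A \<cdot>\<^sub>v x"
    using adj_mat(3)[OF A] x by auto
  finally show ?thesis .
qed

text \<open>With field vectors embedded as constants, an eigenvector or chain relation for
  \<open>A\<close> becomes a polynomial identity for \<open>x I - A\<close>, to which Cramer's rule
  applies.\<close>

lemma char_poly_matrix_mult_const_vec:
  assumes A: "A \<in> carrier_mat n n" and v: "v \<in> carrier_vec n"
  shows "char_poly_matrix A *\<^sub>v map_vec (\<lambda>a. [:a:]) v
    = [:0, 1:] \<cdot>\<^sub>v map_vec (\<lambda>a. [:a:]) v - map_vec (\<lambda>a. [:a:]) (A *\<^sub>v v)"
proof (rule eq_vecI)
  fix i assume "i < dim_vec ([:0, 1:] \<cdot>\<^sub>v map_vec (\<lambda>a. [:a:]) v - map_vec (\<lambda>a. [:a:]) (A *\<^sub>v v))"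
  hence i: "i < n" using A by simp
  have sum_const: "(\<Sum>l\<in>S. [:h l:]) = [:\<Sum>l\<in>S. h l:]" for h :: "nat \<Rightarrow> 'a" and S
    by (induction S rule: infinite_finite_induct) auto
  have "(char_poly_matrix A *\<^sub>v map_vec (\<lambda>a. [:a:]) v) $ i =
    (\<Sum>l = 0..<n. ((if i = l then [:0, 1:] else 0) + [:- A $$ (i, l):]) * [:v $ l:])"
    using A v i by (auto simp: char_poly_matrix_def scalar_prod_def intro!: sum.cong)
  also have "\<dots> = (\<Sum>l = 0..<n. (if i = l then [:0, 1:] * [:v $ l:] else 0) + [:- A $$ (i, l) * v $ l:])"
    by (intro sum.cong refl) (auto simp: algebra_simps)
  also have "\<dots> = [:0, 1:] * [:v $ i:] - [:\<Sum>l = 0..<n. A $$ (i, l) * v $ l:]"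
    using i by (simp add: sum.distrib sum_const sum_negf)
  finally show "(char_poly_matrix A *\<^sub>v map_vec (\<lambda>a. [:a:]) v) $ i =
    ([:0, 1:] \<cdot>\<^sub>v map_vec (\<lambda>a. [:a:]) v - map_vec (\<lambda>a. [:a:]) (A *\<^sub>v v)) $ i"
    using A v i by (auto simp: scalar_prod_def)
qed (use A v in \<open>auto simp: char_poly_matrix_def\<close>)

text \<open>By Cramer's rule, replacing column \<open>i\<close> of \<open>x I - A\<close> by \<open>u\<close> divides the determinant by
  \<open>x - \<theta>\<close>, up to the unit \<open>u $ i\<close>. Since \<open>w $ i = 0\<close>, the vector \<open>w\<close> does not see the new column,
  and a second application of Cramer's rule extracts another factor \<open>x - \<theta>\<close>.\<close>

lemma char_poly_double_root:
  fixes A :: "'a :: field mat" and u w :: "'a vec"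
  assumes A: "A \<in> carrier_mat n n" and u: "u \<in> carrier_vec n" and w: "w \<in> carrier_vec n"
    and Au: "A *\<^sub>v u = \<theta> \<cdot>\<^sub>v u" and Aw: "A *\<^sub>v w = \<theta> \<cdot>\<^sub>v w + c \<cdot>\<^sub>v u"
    and i: "i < n" and ui: "u $ i \<noteq> 0" and wi: "w $ i = 0" and w0: "w \<noteq> 0\<^sub>v n"
  shows "[:- \<theta>, 1:]\<^sup>2 dvd char_poly A"
proof -
  let ?c = "map_vec (\<lambda>a :: 'a. [:a:])"
  define p where "p = [:- \<theta>, 1:]"
  define M where "M = char_poly_matrix A"
  define R where "R = replace_col M (?c u) i"
  have M: "M \<in> carrier_mat n n" using A by (simp add: M_def)
  have R: "R \<in> carrier_mat n n" using M by (auto simp: R_def replace_col_def)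
  have cu: "?c u \<in> carrier_vec n" and cw: "?c w \<in> carrier_vec n" using u w by auto
  obtain j where j: "j < n" "w $ j \<noteq> 0" using w w0 by (auto simp: vec_eq_iff)
  have ij: "i \<noteq> j" using j wi by auto
  have Mu: "M *\<^sub>v ?c u = p \<cdot>\<^sub>v ?c u"
    unfolding M_def char_poly_matrix_mult_const_vec[OF A u] Au
    by (rule eq_vecI) (use u in \<open>auto simp: p_def\<close>)
  have Mw: "M *\<^sub>v ?c w = p \<cdot>\<^sub>v ?c w - [:c:] \<cdot>\<^sub>v ?c u"
    unfolding M_def char_poly_matrix_mult_const_vec[OF A w] Aw
    by (rule eq_vecI) (use u w in \<open>auto simp: p_def\<close>)
  have aR: "adj_mat R \<in> carrier_mat n n" by (rule adj_mat(1)[OF R])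
  have "[:u $ i:] * det M = det (replace_col M (M *\<^sub>v ?c u) i)"
    using cramer_lemma_mat[OF M cu i] u i by simp
  also have "\<dots> = p * det R"
    unfolding Mu R_def by (rule det_replace_col_smult[OF M cu i])
  finally have 1: "[:u $ i:] * det M = p * det R" .
  have RM: "R *\<^sub>v ?c w = M *\<^sub>v ?c w"
    by (rule eq_vecI) (use M w wi in \<open>auto simp: R_def replace_col_def scalar_prod_def intro!: sum.cong\<close>)
  \<comment> \<open>Since \<open>u\<close> is column \<open>i\<close> of \<open>R\<close>, the
    adjugate sends it to a multiple of the \<open>i\<close>-th unit vector.\<close>
  have Ri: "R *\<^sub>v unit_vec n i = ?c u"
    using R M u i by (auto simp: R_def replace_col_def)
  have aRu: "adj_mat R *\<^sub>v ?c u = det R \<cdot>\<^sub>v unit_vec n i"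
    using adj_mat_mult_vec[OF R, of "unit_vec n i"] Ri by simp
  have "det R * [:w $ j:] = (det R \<cdot>\<^sub>v ?c w) $ j" using w j by simp
  also have "det R \<cdot>\<^sub>v ?c w = adj_mat R *\<^sub>v (p \<cdot>\<^sub>v ?c w - [:c:] \<cdot>\<^sub>v ?c u)"
    using adj_mat_mult_vec[OF R cw] RM Mw by simp
  also have "\<dots> = p \<cdot>\<^sub>v (adj_mat R *\<^sub>v ?c w) - [:c:] \<cdot>\<^sub>v (det R \<cdot>\<^sub>v unit_vec n i)"
    unfolding aRu[symmetric] using aR cu cw
    by (subst mult_minus_distrib_mat_vec[of _ n n]) auto
  \<comment> \<open>Coordinate \<open>j\<close> differs from \<open>i\<close>, so the unit vector
    contributes nothing and only the multiple of \<open>p\<close> survives.\<close>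
  also have "\<dots> $ j = p * (adj_mat R *\<^sub>v ?c w) $ j"
    using j ij aR w i by auto
  finally have "p dvd Polynomial.smult (w $ j) (det R)" by (auto simp: mult.commute intro: dvdI)
  hence "p dvd det R" using j by (metis dvd_smult_cancel)
  hence "p\<^sup>2 dvd [:u $ i:] * det M" unfolding 1 power2_eq_square by (intro mult_dvd_mono) auto
  hence "p\<^sup>2 dvd det M" using ui dvd_smult_cancel[of "p\<^sup>2" "u $ i" "det M"] by simp
  thus ?thesis by (simp add: p_def M_def char_poly_def)
qed

text \<open>Covers a second eigenvector (\<open>c = 0\<close>) and a generalized one
  (\<open>c \<noteq> 0\<close>) together. Subtracting the multiple of \<open>u\<close> that clears
  coordinate \<open>i\<close> keeps the relation, and a nonzero remainder would make
  \<open>\<theta>\<close> a double root.\<close>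

lemma simple_root_chain:
  fixes A :: "'a :: field mat"
  assumes A: "A \<in> carrier_mat n n" and u: "u \<in> carrier_vec n" and w: "w \<in> carrier_vec n"
    and u0: "u \<noteq> 0\<^sub>v n"
    and Au: "A *\<^sub>v u = \<theta> \<cdot>\<^sub>v u" and Aw: "A *\<^sub>v w = \<theta> \<cdot>\<^sub>v w + c \<cdot>\<^sub>v u"
    and simple: "\<not> [:- \<theta>, 1:]\<^sup>2 dvd char_poly A"
  shows "\<exists>d. w = d \<cdot>\<^sub>v u"
proof -
  obtain i where i: "i < n" "u $ i \<noteq> 0" using u u0 by (auto simp: vec_eq_iff)
  define d where "d = w $ i / u $ i"
  define w' where "w' = w - d \<cdot>\<^sub>v u"
  have w': "w' \<in> carrier_vec n" using u w by (simp add: w'_def)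
  have "A *\<^sub>v w' = A *\<^sub>v w - d \<cdot>\<^sub>v (A *\<^sub>v u)"
    unfolding w'_def using A u w by (subst mult_minus_distrib_mat_vec[of _ n n]) auto
  also have "\<dots> = \<theta> \<cdot>\<^sub>v w' + c \<cdot>\<^sub>v u"
    unfolding Au Aw w'_def by (rule eq_vecI) (use u w in \<open>auto simp: algebra_simps\<close>)
  finally have Aw': "A *\<^sub>v w' = \<theta> \<cdot>\<^sub>v w' + c \<cdot>\<^sub>v u" .
  have "w' $ i = 0" using u w i by (simp add: w'_def d_def)
  with char_poly_double_root[OF A u w' Au Aw' i(1) i(2)] simple have "w' = 0\<^sub>v n" by blast
  hence "\<forall>j<n. w $ j = d * u $ j" using u w by (auto simp: w'_def vec_eq_iff)
  hence "w = d \<cdot>\<^sub>v u" using u w by (auto simp: vec_eq_iff)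
  thus ?thesis ..
qed

subsection \<open>Polynomials in a matrix\<close>

lemma scalar_mat_mult_vec:
  assumes "v \<in> carrier_vec n"
  shows "(c \<cdot>\<^sub>m 1\<^sub>m n) *\<^sub>v v = c \<cdot>\<^sub>v (v :: 'a :: comm_ring_1 vec)"
  by (rule eq_vecI) (use assms in auto)

lemma dim_mat_poly [simp]: "dim_row (mat_poly p A) = dim_row A" "dim_col (mat_poly p A) = dim_row A"
  by (simp_all add: mat_poly_def)

lemma mat_poly_carrier [simp]: "A \<in> carrier_mat n n \<Longrightarrow> mat_poly p A \<in> carrier_mat n n"
  by (auto simp: mat_poly_def)

text \<open>A free bound \<open>N\<close> allows polynomials of different degrees to be expanded
  over one common range.\<close>

lemma index_mat_poly:
  assumes "A \<in> carrier_mat n n" "i < n" "j < n" "Polynomial.degree p \<le> N"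
  shows "mat_poly p A $$ (i, j) = (\<Sum>k\<le>N. Polynomial.coeff p k * (A ^\<^sub>m k) $$ (i, j))"
proof -
  have "mat_poly p A $$ (i, j) = (\<Sum>k\<le>Polynomial.degree p. Polynomial.coeff p k * (A ^\<^sub>m k) $$ (i, j))"
    using assms by (simp add: mat_poly_def)
  also have "\<dots> = (\<Sum>k\<le>N. Polynomial.coeff p k * (A ^\<^sub>m k) $$ (i, j))"
    using assms by (intro sum.mono_neutral_left) (auto simp: Polynomial.coeff_eq_0)
  finally show ?thesis .
qed

lemma mat_poly_0 [simp]: "A \<in> carrier_mat n n \<Longrightarrow> mat_poly 0 A = 0\<^sub>m n n"
  by (rule eq_matI) (auto simp: mat_poly_def)

lemma mat_poly_add:
  assumes A: "A \<in> carrier_mat n n"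
  shows "mat_poly (p + q) A = mat_poly p A + mat_poly q A"
proof (rule eq_matI)
  fix i j assume "i < dim_row (mat_poly p A + mat_poly q A)" "j < dim_col (mat_poly p A + mat_poly q A)"
  hence ij: "i < n" "j < n" using A by auto
  define N where "N = max (Polynomial.degree p) (Polynomial.degree q)"
  have "Polynomial.degree p \<le> N" "Polynomial.degree q \<le> N" "Polynomial.degree (p + q) \<le> N"
    using degree_add_le_max[of p q] by (auto simp: N_def)
  thus "mat_poly (p + q) A $$ (i, j) = (mat_poly p A + mat_poly q A) $$ (i, j)"
    using ij A
    by (simp add: index_mat_poly[OF A ij, of _ N] sum.distrib algebra_simps)
qed (use A in auto)

lemma mat_poly_smult:
  assumes A: "A \<in> carrier_mat n n"
  shows "mat_poly (Polynomial.smult c p) A = c \<cdot>\<^sub>m mat_poly p A"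
proof (rule eq_matI)
  fix i j assume "i < dim_row (c \<cdot>\<^sub>m mat_poly p A)" "j < dim_col (c \<cdot>\<^sub>m mat_poly p A)"
  hence ij: "i < n" "j < n" using A by auto
  thus "mat_poly (Polynomial.smult c p) A $$ (i, j) = (c \<cdot>\<^sub>m mat_poly p A) $$ (i, j)"
    using A
    by (simp add: index_mat_poly[OF A ij, of _ "Polynomial.degree p"] sum_distrib_left mult.assoc)
qed (use A in auto)

text \<open>Horner's rule: it replaces the entrywise definition by a recursion, on which the
  inductions for products, eigenvectors, field maps and Hermitian symmetry rest.\<close>

lemma mat_poly_pCons:
  assumes A: "A \<in> carrier_mat n n"
  shows "mat_poly (pCons c p) A = c \<cdot>\<^sub>m 1\<^sub>m n + mat_poly p A * A"
proof (rule eq_matI)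
  let ?B = "c \<cdot>\<^sub>m 1\<^sub>m n + mat_poly p A * A"
  fix i j assume "i < dim_row ?B" "j < dim_col ?B"
  hence ij: "i < n" "j < n" using A by auto
  let ?N = "Polynomial.degree p"
  have "mat_poly (pCons c p) A $$ (i, j) =
      (\<Sum>k\<le>Suc ?N. Polynomial.coeff (pCons c p) k * (A ^\<^sub>m k) $$ (i, j))"
    by (rule index_mat_poly[OF A ij]) (rule degree_pCons_le)
  also have "\<dots> = c * (1\<^sub>m n) $$ (i, j) + (\<Sum>k\<le>?N. Polynomial.coeff p k * (A ^\<^sub>m k * A) $$ (i, j))"
    using A by (simp add: sum.atMost_Suc_shift del: sum.atMost_Suc)
  also have "(\<Sum>k\<le>?N. Polynomial.coeff p k * (A ^\<^sub>m k * A) $$ (i, j)) =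
      (\<Sum>k\<le>?N. \<Sum>l<n. Polynomial.coeff p k * (A ^\<^sub>m k) $$ (i, l) * A $$ (l, j))"
    using A ij by (simp add: scalar_prod_def sum_distrib_left mult.assoc atLeast0LessThan)
  also have "\<dots> = (\<Sum>l<n. (\<Sum>k\<le>?N. Polynomial.coeff p k * (A ^\<^sub>m k) $$ (i, l)) * A $$ (l, j))"
    by (subst sum.swap) (simp add: sum_distrib_right)
  also have "\<dots> = (\<Sum>l<n. mat_poly p A $$ (i, l) * A $$ (l, j))"
    using ij by (intro sum.cong refl) (simp add: index_mat_poly[OF A, of _ _ _ ?N])
  also have "\<dots> = (mat_poly p A * A) $$ (i, j)"
    using A ij by (simp add: scalar_prod_def atLeast0LessThan)
  finally show "mat_poly (pCons c p) A $$ (i, j) = ?B $$ (i, j)"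
    using A ij by simp
qed (use A in auto)

lemma mat_poly_commute:
  assumes A: "A \<in> carrier_mat n n"
  shows "A * mat_poly p A = mat_poly p A * A"
proof (induction p)
  case (pCons c p)
  have P: "mat_poly p A \<in> carrier_mat n n" using A by simp
  have "A * mat_poly (pCons c p) A = c \<cdot>\<^sub>m A + A * (mat_poly p A * A)"
    unfolding mat_poly_pCons[OF A] using A P
    by (subst mult_add_distrib_mat[of _ n n _ n]) auto
  also have "A * (mat_poly p A * A) = mat_poly p A * A * A"
    using A P pCons by (subst assoc_mult_mat[symmetric, of _ n n _ n _ n]) auto
  also have "c \<cdot>\<^sub>m A + \<dots> = mat_poly (pCons c p) A * A"
    unfolding mat_poly_pCons[OF A] using A P
    by (subst add_mult_distrib_mat[of _ n n _ _ n]) auto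
  finally show ?case .
qed (use A in auto)

lemma mat_poly_mult:
  assumes A: "A \<in> carrier_mat n n"
  shows "mat_poly (p * q) A = mat_poly p A * mat_poly q A"
proof (induction p)
  case 0
  show ?case using A by (simp add: left_mult_zero_mat[of _ n n])
next
  case (pCons c p)
  have P: "mat_poly p A \<in> carrier_mat n n" and Q: "mat_poly q A \<in> carrier_mat n n"
    using A by auto
  have "mat_poly (pCons c p * q) A = c \<cdot>\<^sub>m mat_poly q A + mat_poly p A * mat_poly q A * A"
    using A P Q pCons
    by (simp add: mat_poly_add mat_poly_smult mat_poly_pCons) (intro eq_matI; simp)
  \<comment> \<open>Horner's rule leaves \<open>A\<close> on the far right; commuting it past
    \<open>mat_poly q A\<close> brings it back next to \<open>mat_poly p A\<close>.\<close>
  also have "mat_poly p A * mat_poly q A * A = mat_poly p A * A * mat_poly q A"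
    using A P Q by (simp add: assoc_mult_mat[of _ n n _ n _ n] mat_poly_commute[OF A])
  also have "c \<cdot>\<^sub>m mat_poly q A + \<dots> = mat_poly (pCons c p) A * mat_poly q A"
    unfolding mat_poly_pCons[OF A] using A P Q
    by (subst add_mult_distrib_mat[of _ n n _ _ n]) auto
  finally show ?case .
qed

lemma mat_poly_eigenvector:
  assumes A: "A \<in> carrier_mat n n" and u: "u \<in> carrier_vec n" and Au: "A *\<^sub>v u = \<theta> \<cdot>\<^sub>v u"
  shows "mat_poly p A *\<^sub>v u = poly p \<theta> \<cdot>\<^sub>v u"
proof (induction p)
  case 0
  show ?case using A u by auto
next
  case (pCons c p)
  have P: "mat_poly p A \<in> carrier_mat n n" using A by simp
  have "mat_poly (pCons c p) A *\<^sub>v u = c \<cdot>\<^sub>v u + mat_poly p A *\<^sub>v (A *\<^sub>v u)"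
    unfolding mat_poly_pCons[OF A] using A P u
    by (subst add_mult_distrib_mat_vec[of _ n n]) (auto simp: assoc_mult_mat_vec[of _ n n _ n])
  also have "\<dots> = c \<cdot>\<^sub>v u + \<theta> \<cdot>\<^sub>v (poly p \<theta> \<cdot>\<^sub>v u)"
    unfolding Au using P u pCons by (simp add: mult_mat_vec[of _ n n])
  also have "\<dots> = poly (pCons c p) \<theta> \<cdot>\<^sub>v u"
    by (rule eq_vecI) (use u in \<open>auto simp: algebra_simps\<close>)
  finally show ?case .
qed

lemma map_mat_mat_poly:
  fixes h :: "'a :: field \<Rightarrow> 'b :: field"
  assumes A: "A \<in> carrier_mat n n" and h: "comm_ring_hom h"
  shows "map_mat h (mat_poly p A) = mat_poly (map_poly h p) (map_mat h A)"
proof -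
  interpret comm_ring_hom h by fact
  show ?thesis
  proof (induction p)
    case 0
    show ?case using A by (auto simp: map_poly_0)
  next
    case (pCons c p)
    have P: "mat_poly p A \<in> carrier_mat n n" using A by simp
    have "map_mat h (mat_poly (pCons c p) A) = h c \<cdot>\<^sub>m 1\<^sub>m n + map_mat h (mat_poly p A * A)"
      unfolding mat_poly_pCons[OF A] by (rule eq_matI) (use A P in \<open>auto simp: hom_add hom_mult\<close>)
    also have "map_mat h (mat_poly p A * A) = map_mat h (mat_poly p A) * map_mat h A"
      using A P by (rule mat_hom_mult[rotated])
    finally show ?case using A pCons by (simp add: mat_poly_pCons[of _ n])
  qed
qed

text \<open>Peel off one linear factor \<open>x - a\<close> of \<open>p\<close> at a time. If \<open>a\<close> is not an eigenvalue, \<open>A - a I\<close>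
  is injective; if \<open>a = \<theta>\<close>, the simplicity of \<open>\<theta>\<close> rules out generalized eigenvectors.\<close>

lemma mat_poly_kernel:
  fixes A :: "'a :: alg_closed_field mat"
  assumes A: "A \<in> carrier_mat n n" and u: "u \<in> carrier_vec n" and u0: "u \<noteq> 0\<^sub>v n"
    and Au: "A *\<^sub>v u = \<theta> \<cdot>\<^sub>v u" and simple: "\<not> [:- \<theta>, 1:]\<^sup>2 dvd char_poly A"
    and "p \<noteq> 0" and "\<And>a. poly p a = 0 \<Longrightarrow> poly (char_poly A) a = 0 \<Longrightarrow> a = \<theta>"
    and "v \<in> carrier_vec n" and "mat_poly p A *\<^sub>v v = 0\<^sub>v n"
  shows "\<exists>c. v = c \<cdot>\<^sub>v u"
  using assms(6-9)
proof (induction "Polynomial.degree p" arbitrary: p v)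
  case 0
  then obtain c where p: "p = [:c:]" "c \<noteq> 0" by (metis degree_eq_zeroE pCons_0_0)
  have "0\<^sub>v n = c \<cdot>\<^sub>v v"
    using A 0 by (subst 0(5)[symmetric])
      (auto simp: p mat_poly_pCons[OF A] scalar_mat_mult_vec)
  hence "\<forall>i<n. v $ i = 0" using p 0(4) by (auto simp: vec_eq_iff)
  hence "v = 0 \<cdot>\<^sub>v u" using 0(4) u by (auto simp: vec_eq_iff)
  thus ?case ..
next
  case (Suc d)
  obtain a where a: "poly p a = 0"
    using alg_closed_imp_poly_has_root[of p] Suc.hyps(2) by (metis zero_less_Suc)
  then obtain p' where p: "p = p' * [:- a, 1:]" by (metis poly_eq_0_iff_dvd dvdE mult.commute)
  have p'0: "p' \<noteq> 0" using Suc.prems p by auto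
  have P': "mat_poly p' A \<in> carrier_mat n n" using A by simp
  define w where "w = A *\<^sub>v v - a \<cdot>\<^sub>v v"
  have v: "v \<in> carrier_vec n" by fact
  have w: "w \<in> carrier_vec n" using A v by (auto simp: w_def)
  have lin: "mat_poly [:- a, 1:] A *\<^sub>v v = w"
  proof -
    have "(1 \<cdot>\<^sub>m 1\<^sub>m n :: 'a mat) = 1\<^sub>m n" by (rule eq_matI) auto
    hence "mat_poly [:- a, 1:] A *\<^sub>v v = - a \<cdot>\<^sub>v v + A *\<^sub>v v"
      using A v by (simp add: mat_poly_pCons[OF A] add_mult_distrib_mat_vec[of _ n n] scalar_mat_mult_vec)
    also have "\<dots> = w" unfolding w_def by (rule eq_vecI) (use A v in auto)
    finally show ?thesis .
  qed
  have "mat_poly p A = mat_poly p' A * mat_poly [:- a, 1:] A"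
    unfolding p by (rule mat_poly_mult[OF A])
  hence "mat_poly p' A *\<^sub>v w = 0\<^sub>v n"
    using Suc.prems(4) P' A v by (simp add: assoc_mult_mat_vec[of _ n n _ n] lin)
  moreover have "d = Polynomial.degree p'"
    using Suc.hyps(2) p'0 degree_mult_eq[OF p'0, of "[:- a, 1:]"] unfolding p by simp
  \<comment> \<open>Every root of \<open>p'\<close> is a root of \<open>p\<close>, so the induction
    hypothesis places \<open>w\<close>, which is \<open>A - a I\<close> applied to \<open>v\<close>,
    on the line of \<open>u\<close>.\<close>
  ultimately obtain c where c: "w = c \<cdot>\<^sub>v u"
    using Suc.hyps(1)[OF _ p'0 _ w] Suc.prems(2) by (auto simp: p)
  show ?case
  proof (cases "a = \<theta>")
    case True
    have "A *\<^sub>v v = \<theta> \<cdot>\<^sub>v v + c \<cdot>\<^sub>v u"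
      unfolding c[symmetric] w_def True by (rule eq_vecI) (use A v in auto)
    from simple_root_chain[OF A u v u0 Au this simple] show ?thesis .
  next
    case False
    \<comment> \<open>On \<open>u\<close> the matrix \<open>A - a I\<close> acts as
      \<open>\<theta> - a\<close>, so this \<open>e\<close> makes it send \<open>e u\<close> to
      \<open>c u = w\<close>. Hence it kills \<open>z = v - e u\<close>.\<close>
    define e where "e = c / (\<theta> - a)"
    define z where "z = v - e \<cdot>\<^sub>v u"
    have z: "z \<in> carrier_vec n" using v u by (simp add: z_def)
    have "A *\<^sub>v v = a \<cdot>\<^sub>v v + c \<cdot>\<^sub>v u"
      unfolding c[symmetric] w_def by (rule eq_vecI) (use A v in auto)
    moreover have "A *\<^sub>v z = A *\<^sub>v v - e \<cdot>\<^sub>v (A *\<^sub>v u)"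
      unfolding z_def using A u v by (subst mult_minus_distrib_mat_vec[of _ n n]) auto
    moreover have "c = e * (\<theta> - a)" using False by (simp add: e_def)
    ultimately have Az: "A *\<^sub>v z = a \<cdot>\<^sub>v z"
      unfolding Au z_def by (intro eq_vecI) (use u v in \<open>auto simp: algebra_simps\<close>)
    have "poly (char_poly A) a \<noteq> 0" using Suc.prems(2) a False by blast
    hence "\<not> eigenvalue A a" by (simp add: eigenvalue_root_char_poly[OF A])
    hence "z = 0\<^sub>v n" using Az z A by (auto simp: eigenvalue_def eigenvector_def)
    hence "v = e \<cdot>\<^sub>v u" using u v by (auto simp: z_def vec_eq_iff)
    thus ?thesis ..
  qed
qed

subsection \<open>Linear codes as images\<close>

text \<open>Rank-nullity with trivial kernel. The code and its hull are both presented as such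
  images.\<close>

lemma linear_code_image:
  fixes B :: "'a :: field mat"
  assumes B: "B \<in> carrier_mat N m"
    and inj: "\<And>x. x \<in> carrier_vec m \<Longrightarrow> B *\<^sub>v x = 0\<^sub>v N \<Longrightarrow> x = 0\<^sub>v m"
  shows "linear_code N m ((\<lambda>x. B *\<^sub>v x) ` carrier_vec m)"
proof -
  interpret V: vec_space "TYPE('a)" m .
  interpret W: vec_space "TYPE('a)" N .
  interpret T: linear_map class_ring V.V W.V "\<lambda>x. B *\<^sub>v x"
    by unfold_locales
      (use B in \<open>auto simp: module_hom_def mult_add_distrib_mat_vec[of _ N m] mult_mat_vec[of _ N m]
        module_vec_simps\<close>)
  have im: "T.imT = (\<lambda>x. B *\<^sub>v x) ` carrier_vec m" by (simp add: T.im_def)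
  have "inj_on (\<lambda>x. B *\<^sub>v x) (carrier V.V)"
    by (rule T.Ke0_imp_inj) (use inj B in \<open>auto simp: T.ker_def\<close>)
  from T.inj_imp_dim_ker0[OF this] T.rank_nullity[OF V.fin_dim]
  have "vectorspace.dim class_ring (W.vs T.imT) = m" by (simp add: V.dim_is_n)
  with T.imT_is_subspace show ?thesis by (simp add: linear_code_def code_dim_def im)
qed

subsection \<open>Descent from the algebraic closure\<close>

lemma to_ac_hom: "field_hom (to_ac :: 'a :: field \<Rightarrow> 'a alg_closure)"
  by unfold_locales auto

text \<open>The polynomial \<open>p\<close> may vanish, e.g. for \<open>n = 1\<close>, \<open>t = 2\<close> and \<open>f 1 = 1\<close> in characteristic two.\<close>

lemma mat_poly_kernel_line:
  fixes A :: "'a :: field mat" and \<theta> :: "'a alg_closure"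
  defines "\<chi> \<equiv> char_poly (map_mat to_ac A)"
  assumes A: "A \<in> carrier_mat n n" and root: "poly \<chi> \<theta> = 0" and simple: "\<not> [:- \<theta>, 1:]\<^sup>2 dvd \<chi>"
    and p\<theta>: "poly_ac p \<theta> = 0"
    and only: "\<And>a. poly_ac p a = 0 \<Longrightarrow> poly \<chi> a = 0 \<Longrightarrow> a = \<theta>"
    and deg: "p \<noteq> 0 \<or> n = 1"
  obtains u where "u \<in> carrier_vec n" "u \<noteq> 0\<^sub>v n" "mat_poly p A *\<^sub>v u = 0\<^sub>v n"
    "\<And>v. v \<in> carrier_vec n \<Longrightarrow> mat_poly p A *\<^sub>v v = 0\<^sub>v n \<Longrightarrow> \<exists>c. v = c \<cdot>\<^sub>v u"
proof -
  interpret h: field_hom "to_ac :: 'a \<Rightarrow> 'a alg_closure" by (rule to_ac_hom)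
  define A' where "A' = map_mat to_ac A"
  define p' where "p' = map_poly to_ac p"
  define P where "P = mat_poly p A"
  have A': "A' \<in> carrier_mat n n" and P: "P \<in> carrier_mat n n"
    using A by (auto simp: A'_def P_def)
  have P': "map_mat to_ac P = mat_poly p' A'"
    unfolding P_def p'_def A'_def by (rule map_mat_mat_poly[OF A]) unfold_locales
  obtain w where w: "w \<in> carrier_vec n" "w \<noteq> 0\<^sub>v n" "A' *\<^sub>v w = \<theta> \<cdot>\<^sub>v w"
    using root A' eigenvalue_root_char_poly[OF A']
    by (auto simp: \<chi>_def A'_def[symmetric] eigenvalue_def eigenvector_def)
  have "map_mat to_ac P *\<^sub>v w = 0\<^sub>v n"
    using mat_poly_eigenvector[OF A' w(1,3), of p'] p\<theta> w(1)
    unfolding P' by (auto simp: poly_ac_def p'_def)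
  \<comment> \<open>The eigenvector \<open>w\<close> may have entries outside the base field. The
    determinant, however, is the image of \<open>det P\<close>, so its vanishing descends and gives
    a kernel vector over the base field.\<close>
  hence "det (map_mat to_ac P) = 0"
    using det_0_iff_vec_prod_zero[of "map_mat to_ac P" n] P w by auto
  hence "det P = 0" by simp
  then obtain u where u: "u \<in> carrier_vec n" "u \<noteq> 0\<^sub>v n" "P *\<^sub>v u = 0\<^sub>v n"
    using det_0_iff_vec_prod_zero[OF P] by auto
  have line: "\<exists>c. map_vec to_ac v = c \<cdot>\<^sub>v w" if v: "v \<in> carrier_vec n" "P *\<^sub>v v = 0\<^sub>v n" for v
  proof (cases "p = 0")
    case False
    have "p' \<noteq> 0" using False by (simp add: p'_def)
    moreover have "mat_poly p' A' *\<^sub>v map_vec to_ac v = 0\<^sub>v n"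
      unfolding P'[symmetric] h.mult_mat_vec_hom[OF P v(1), symmetric] v(2) by auto
    ultimately show ?thesis
      using v(1) only simple
      by (intro mat_poly_kernel[OF A' w(1,2,3)])
        (auto simp: \<chi>_def A'_def[symmetric] poly_ac_def p'_def)
  next
    \<comment> \<open>Here \<open>p(A)\<close> is zero, and the whole space is a line because
      \<open>n = 1\<close>.\<close>
    case True
    with deg have n: "n = 1" by simp
    have "w $ 0 \<noteq> (0 :: 'a alg_closure)" using w n by (auto simp: vec_eq_iff)
    hence "map_vec to_ac v = (to_ac (v $ 0) / w $ 0) \<cdot>\<^sub>v w"
      using v w n by (auto simp: vec_eq_iff)
    thus ?thesis ..
  qed
  obtain i where i: "i < n" "u $ i \<noteq> (0 :: 'a)" using u by (auto simp: vec_eq_iff)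
  show thesis
  proof (rule that[OF u(1,2)])
    fix v assume v: "v \<in> carrier_vec n" "mat_poly p A *\<^sub>v v = 0\<^sub>v n"
    obtain c d where c: "map_vec to_ac v = c \<cdot>\<^sub>v w" and d: "map_vec to_ac u = d \<cdot>\<^sub>v w"
      using line u v by (metis P_def)
    have "v $ j = v $ i / u $ i * u $ j" if "j < n" for j
    proof -
      have *: "to_ac (v $ k) = c * w $ k" "to_ac (u $ k) = d * w $ k" if "k < n" for k
        using arg_cong[OF c, of "\<lambda>x. x $ k"] arg_cong[OF d, of "\<lambda>x. x $ k"] that u v w by auto
      \<comment> \<open>Both vectors are multiples of \<open>w\<close> over the closure;
        cross-multiplying removes \<open>c\<close> and \<open>d\<close>, so by injectivity of
        \<open>to_ac\<close> the ratio lies in the base field.\<close>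
      have "to_ac (v $ j * u $ i) = to_ac (v $ i * u $ j)"
        using i that by (simp add: *)
      hence "v $ j * u $ i = v $ i * u $ j" by (simp only: to_ac_eq_iff)
      thus ?thesis using i by (simp add: field_simps)
    qed
    hence "v = (v $ i / u $ i) \<cdot>\<^sub>v u" using u v by (auto simp: vec_eq_iff)
    thus "\<exists>c. v = c \<cdot>\<^sub>v u" ..
  qed (use u in \<open>simp add: P_def\<close>)
qed

text \<open>The uniqueness concerns the index, and indices count multiplicity. It therefore says
  both that \<open>lam i\<close> is a simple root of \<open>\<chi>\<close> and that no other root of
  \<open>\<chi>\<close> is a root of \<open>p\<close>.\<close>

lemma unique_listed_root_kernel_line:
  fixes A :: "'a :: field mat"
  assumes A: "A \<in> carrier_mat n n" and lam: "eigenvalues_listed n A lam"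
    and uniq: "\<exists>!i. i \<in> {1..n} \<and> poly_ac p (lam i) = 0"
  obtains u where "u \<in> carrier_vec n" "u \<noteq> 0\<^sub>v n" "mat_poly p A *\<^sub>v u = 0\<^sub>v n"
    "\<And>v. v \<in> carrier_vec n \<Longrightarrow> mat_poly p A *\<^sub>v v = 0\<^sub>v n \<Longrightarrow> \<exists>c. v = c \<cdot>\<^sub>v u"
proof -
  define \<chi> where "\<chi> = char_poly (map_mat to_ac A)"
  have \<chi>: "proots \<chi> = image_mset lam (mset_set {1..n})"
    using lam by (simp add: eigenvalues_listed_def \<chi>_def)
  have "\<chi> \<noteq> 0"
    using degree_monic_char_poly[of "map_mat to_ac A" n] A unfolding \<chi>_def
    by (metis Polynomial.coeff_0 map_carrier_mat zero_neq_one)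
  obtain i where i: "i \<in> {1..n}" "poly_ac p (lam i) = 0"
    and i_uniq: "\<And>j. j \<in> {1..n} \<Longrightarrow> poly_ac p (lam j) = 0 \<Longrightarrow> j = i"
    using uniq by blast
  have roots: "poly \<chi> a = 0 \<longleftrightarrow> a \<in> lam ` {1..n}" for a
    using set_count_proots[OF \<open>\<chi> \<noteq> 0\<close>] by (auto simp: \<chi>)
  \<comment> \<open>An index \<open>j\<close> with the same eigenvalue would satisfy the root
    condition as well.\<close>
  have "lam -` {lam i} \<inter> {1..n} = {i}"
    using i by (intro equalityI subsetI) (metis IntE singletonD singletonI vimageE i_uniq, simp)
  hence "count (image_mset lam (mset_set {1..n})) (lam i) = 1"
    using i by (simp add: count_image_mset Int_commute)
  hence "Polynomial.order (lam i) \<chi> = 1"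
    by (metis \<chi> \<open>\<chi> \<noteq> 0\<close> count_proots)
  hence simple: "\<not> [:- lam i, 1:]\<^sup>2 dvd \<chi>"
    using \<open>\<chi> \<noteq> 0\<close> by (simp add: order_divides)
  \<comment> \<open>The zero polynomial vanishes at every eigenvalue, so the indices
    \<open>1\<close> and \<open>n\<close> must coincide.\<close>
  have "n = 1" if "p = 0"
    using i_uniq[of 1] i_uniq[of n] i that by (auto simp: poly_ac_def)
  hence deg: "p \<noteq> 0 \<or> n = 1" by blast
  have only: "a = lam i" if a: "poly_ac p a = 0" "poly \<chi> a = 0" for a
  proof -
    obtain j where "j \<in> {1..n}" "a = lam j" using iffD1[OF roots a(2)] by (rule imageE) blast
    thus ?thesis using a(1) i_uniq by metis
  qed
  have "poly \<chi> (lam i) = 0" using i by (simp only: roots imageI)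
  thus thesis
    by (rule mat_poly_kernel_line[OF A _ _ i(2) _ deg, folded \<chi>_def]) (fact simple only that)+
qed

subsection \<open>Hermitian Gram matrices\<close>

lemma frobenius_hom:
  assumes "primepow q" "CARD('a :: finite_field) = q\<^sup>2"
  shows "comm_ring_hom (\<lambda>x :: 'a. x ^ q)"
proof -
  have q: "q > 0" using assms(1) by (simp add: primepow_gt_0_nat)
  show ?thesis
    by unfold_locales (auto simp: frobenius_add[OF assms] power_mult_distrib q zero_power)
qed

lemma frobenius_involution:
  fixes x :: "'a :: finite_field"
  assumes "CARD('a) = q\<^sup>2"
  shows "(x ^ q) ^ q = x"
  using finite_field_power_card_eq_same[of x] assms by (simp add: power2_eq_square power_mult)

lemma bar_mat_carrier [simp]: "bar_mat q M \<in> carrier_mat m n \<longleftrightarrow> M \<in> carrier_mat m n"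
  by (simp add: bar_mat_def)

lemma bar_vec_carrier [simp]: "bar_vec q v \<in> carrier_vec n \<longleftrightarrow> v \<in> carrier_vec n"
  by (simp add: bar_vec_def)

lemma bar_vec_bar_vec:
  fixes v :: "'a :: finite_field vec"
  assumes "CARD('a) = q\<^sup>2"
  shows "bar_vec q (bar_vec q v) = v"
  by (rule eq_vecI) (simp_all add: bar_vec_def frobenius_involution[OF assms])

lemma bar_vec_smult: "bar_vec q (c \<cdot>\<^sub>v v) = c ^ q \<cdot>\<^sub>v bar_vec q v"
  by (rule eq_vecI) (simp_all add: bar_vec_def power_mult_distrib)

text \<open>Conjugation fixes the coefficients. Transposition reverses products, which is harmless
  because \<open>A\<close> commutes with its own polynomials.\<close>

lemma hermitian_mat_mat_poly:
  fixes A :: "'a :: finite_field mat"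
  assumes q: "primepow q" "CARD('a) = q\<^sup>2" and A: "A \<in> carrier_mat n n" and herm: "hermitian_mat q A"
    and coeffs: "\<And>i. Polynomial.coeff p i \<in> Fq q"
  shows "hermitian_mat q (mat_poly p A)"
  unfolding hermitian_mat_def using coeffs
proof (induction p)
  case 0
  interpret comm_ring_hom "\<lambda>x :: 'a. x ^ q" by (rule frobenius_hom[OF q])
  show ?case using A by (auto simp: bar_mat_def mat_eq_iff)
next
  case (pCons c p)
  interpret comm_ring_hom "\<lambda>x :: 'a. x ^ q" by (rule frobenius_hom[OF q])
  have P: "mat_poly p A \<in> carrier_mat n n" using A by simp
  have c: "c ^ q = c" using pCons.prems[of 0] by (simp add: Fq_def)
  have "Polynomial.coeff p i \<in> Fq q" for i using pCons.prems[of "Suc i"] by simp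
  hence IH: "transpose_mat (bar_mat q (mat_poly p A)) = mat_poly p A" by (rule pCons.IH)
  have "bar_mat q (mat_poly (pCons c p) A) = c \<cdot>\<^sub>m 1\<^sub>m n + bar_mat q (mat_poly p A * A)"
    unfolding mat_poly_pCons[OF A] bar_mat_def
    by (rule eq_matI) (use A P c in \<open>auto simp: hom_add hom_mult\<close>)
  also have "bar_mat q (mat_poly p A * A) = bar_mat q (mat_poly p A) * bar_mat q A"
    unfolding bar_mat_def by (rule mat_hom_mult[OF P A])
  finally have "transpose_mat (bar_mat q (mat_poly (pCons c p) A)) =
      transpose_mat (c \<cdot>\<^sub>m 1\<^sub>m n) + transpose_mat (bar_mat q (mat_poly p A) * bar_mat q A)"
    using A P by (simp add: transpose_add[of _ n n] mult_carrier_mat[of _ n n _ n])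
  also have "transpose_mat (bar_mat q (mat_poly p A) * bar_mat q A) = A * mat_poly p A"
    using A P herm IH by (simp add: transpose_mult[of _ n n _ n] hermitian_mat_def)
  also have "transpose_mat (c \<cdot>\<^sub>m 1\<^sub>m n) = c \<cdot>\<^sub>m 1\<^sub>m n" by (rule eq_matI) auto
  finally show ?case using A by (simp add: mat_poly_pCons mat_poly_commute)
qed

lemma index_mat_poly_sum:
  assumes A: "A \<in> carrier_mat n n" and "i < n" "j < n"
  shows "mat_poly (\<Sum>k\<in>S. p k) A $$ (i, j) = (\<Sum>k\<in>S. mat_poly (p k) A $$ (i, j))"
  using assms by (induction S rule: infinite_finite_induct) (auto simp: mat_poly_add[OF A])

text \<open>Reading the identity block as the constant polynomial \<open>1\<close> at index
  \<open>0\<close> makes every block a polynomial in \<open>A\<close>, so all are treated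
  alike.\<close>

lemma gen_mat_eq_block_row:
  assumes A: "A \<in> carrier_mat n n" and t: "t \<ge> 1"
  shows "gen_mat n t f A = block_row n (map (\<lambda>k. mat_poly ((f(0 := 1)) k) A) [0..<t])"
proof -
  have "mat_poly 1 A = 1\<^sub>m n"
    using A by (simp add: one_pCons mat_poly_pCons) (intro eq_matI; simp)
  moreover have "[0..<t] = 0 # [1..<t]" using t by (simp add: upt_conv_Cons)
  ultimately show ?thesis by (auto simp: gen_mat_def intro!: arg_cong[of _ _ "block_row n"])
qed

lemma gen_mat_carrier:
  assumes "t \<ge> 1"
  shows "gen_mat n t f A \<in> carrier_mat n (t * n)"
  using assms by (simp add: gen_mat_def block_row_def)

text \<open>Each Hermitian block multiplied by its conjugate transpose is its square, and the
  product with the full conjugate transpose is the sum of these squares. The identity block supplies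
  the summand \<open>1\<close>.\<close>

lemma gen_mat_gram:
  fixes A :: "'a :: finite_field mat"
  assumes q: "primepow q" "CARD('a) = q\<^sup>2" and A: "A \<in> carrier_mat n n" and herm: "hermitian_mat q A"
    and t: "t \<ge> 1" and coeffs: "\<And>k i. k \<in> {1..t-1} \<Longrightarrow> Polynomial.coeff (f k) i \<in> Fq q"
  shows "gen_mat n t f A * transpose_mat (bar_mat q (gen_mat n t f A)) =
    mat_poly (1 + (\<Sum>k=1..t-1. (f k)\<^sup>2)) A"
proof -
  define F where "F = f(0 := 1)"
  define B where "B = (\<lambda>k. mat_poly (F k) A)"
  define G where "G = gen_mat n t f A"
  have G: "G \<in> carrier_mat n (t * n)" unfolding G_def by (rule gen_mat_carrier[OF t])
  have G_block: "G = block_row n (map B [0..<t])"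
    unfolding G_def B_def F_def by (rule gen_mat_eq_block_row[OF A t])
  have B: "B k \<in> carrier_mat n n" for k using A by (simp add: B_def)
  have F_coeff: "Polynomial.coeff (F k) i \<in> Fq q" if "k < t" for k i
    using that coeffs[of k i] Fq_subfield(1,2)[OF q] by (auto simp: F_def one_pCons coeff_pCons split: nat.split)
  have herm_B: "B k $$ (j, i) ^ q = B k $$ (i, j)" if "k < t" "i < n" "j < n" for k i j
  proof -
    have "hermitian_mat q (B k)"
      unfolding B_def by (rule hermitian_mat_mat_poly[OF q A herm F_coeff[OF that(1)]])
    hence "transpose_mat (bar_mat q (B k)) $$ (i, j) = B k $$ (i, j)"
      by (simp add: hermitian_mat_def)
    thus ?thesis using B[of k] that by (simp add: bar_mat_def)
  qed
  have G_index: "G $$ (i, k * n + m) = B k $$ (i, m)" if "i < n" "k < t" "m < n" for i k m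
  proof -
    have "k * n + m < t * n"
      using that by (metis add.commute add_less_cancel_left less_le_trans mult_Suc mult_le_mono1 Suc_leI)
    thus ?thesis using that by (simp add: G_block block_row_def)
  qed
  have "1 + (\<Sum>k=1..t-1. (f k)\<^sup>2) = (\<Sum>k<t. F k * F k)"
  proof -
    have "{..<t} = insert 0 {1..t-1}" using t by auto
    thus ?thesis by (simp add: F_def power2_eq_square)
  qed
  moreover have "G * transpose_mat (bar_mat q G) = mat_poly (\<Sum>k<t. F k * F k) A"
  proof (rule eq_matI)
    fix i j assume "i < dim_row (mat_poly (\<Sum>k<t. F k * F k) A)"
      "j < dim_col (mat_poly (\<Sum>k<t. F k * F k) A)"
    hence ij: "i < n" "j < n" using A by auto
    let ?g = "\<lambda>l. G $$ (i, l) * G $$ (j, l) ^ q"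
    have "(G * transpose_mat (bar_mat q G)) $$ (i, j) = (\<Sum>l<t * n. ?g l)"
      using G ij by (simp add: scalar_prod_def bar_mat_def atLeast0LessThan)
    \<comment> \<open>The \<open>t * n\<close> columns are grouped into \<open>t\<close> blocks of
      \<open>n\<close>.\<close>
    also have "\<dots> = (\<Sum>k<t. \<Sum>l\<in>{k * n..<k * n + n}. ?g l)" by (rule sum.nat_group[symmetric])
    also have "\<dots> = (\<Sum>k<t. (B k * B k) $$ (i, j))"
    proof (rule sum.cong[OF refl])
      fix k assume "k \<in> {..<t}"
      hence k: "k < t" by simp
      have "(\<Sum>l\<in>{k * n..<k * n + n}. ?g l) = (\<Sum>m<n. ?g (k * n + m))"
        using sum.shift_bounds_nat_ivl[of ?g 0 "k * n" n] by (simp add: atLeast0LessThan add.commute)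
      also have "\<dots> = (\<Sum>m<n. B k $$ (i, m) * B k $$ (m, j))"
        using k ij by (intro sum.cong refl) (simp add: G_index herm_B)
      also have "\<dots> = (B k * B k) $$ (i, j)"
        using B[of k] ij by (simp add: scalar_prod_def atLeast0LessThan)
      finally show "(\<Sum>l\<in>{k * n..<k * n + n}. ?g l) = (B k * B k) $$ (i, j)" .
    qed
    also have "\<dots> = mat_poly (\<Sum>k<t. F k * F k) A $$ (i, j)"
      by (simp add: index_mat_poly_sum[OF A ij] B_def mat_poly_mult[OF A])
    finally show "(G * transpose_mat (bar_mat q G)) $$ (i, j) = mat_poly (\<Sum>k<t. F k * F k) A $$ (i, j)" .
  qed (use G A in auto)
  ultimately show ?thesis by (simp add: G_def)
qed

subsection \<open>The Hermitian hull of a row space\<close>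

lemma code_of_eq_image:
  assumes G: "G \<in> carrier_mat n N"
  shows "code_of G = (\<lambda>x. transpose_mat G *\<^sub>v x) ` carrier_vec n"
proof -
  have "code_of G = vec_space.row_space N G" using G by (simp add: code_of_def)
  also have "\<dots> = (\<lambda>x. transpose_mat G *\<^sub>v x) ` carrier_vec n"
    using vec_space.row_space_eq[OF G] G by auto
  finally show ?thesis .
qed

text \<open>Moving \<open>G\<close> across the scalar product turns orthogonality to the whole code
  into \<open>z \<bullet> (?H *\<^sub>v bar_vec q x) = 0\<close> for every \<open>z\<close>. The bar
  falls on \<open>x\<close> because the form conjugates its second argument.\<close>

lemma hermitian_hull_code_of:
  fixes G :: "'a :: finite_field mat"
  assumes q: "primepow q" "CARD('a) = q\<^sup>2" and G: "G \<in> carrier_mat n N"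
  shows "hermitian_hull q N (code_of G) = (\<lambda>x. transpose_mat G *\<^sub>v x) `
    {x \<in> carrier_vec n. (G * transpose_mat (bar_mat q G)) *\<^sub>v bar_vec q x = 0\<^sub>v n}"
proof -
  interpret comm_ring_hom "\<lambda>x :: 'a. x ^ q" by (rule frobenius_hom[OF q])
  let ?H = "G * transpose_mat (bar_mat q G)"
  have H: "?H \<in> carrier_mat n n" using G by simp
  have inner: "(transpose_mat G *\<^sub>v z) \<bullet> bar_vec q (transpose_mat G *\<^sub>v x) = z \<bullet> (?H *\<^sub>v bar_vec q x)"
    if x: "x \<in> carrier_vec n" and z: "z \<in> carrier_vec n" for x z
  proof -
    have "bar_vec q (transpose_mat G *\<^sub>v x) = map_mat (\<lambda>x. x ^ q) (transpose_mat G) *\<^sub>v bar_vec q x"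
      unfolding bar_vec_def using G x by (intro mult_mat_vec_hom[of _ N n]) auto
    also have "map_mat (\<lambda>x. x ^ q) (transpose_mat G) = transpose_mat (bar_mat q G)"
      by (simp add: bar_mat_def map_mat_transpose)
    finally have "(transpose_mat G *\<^sub>v z) \<bullet> bar_vec q (transpose_mat G *\<^sub>v x) =
        (transpose_mat G *\<^sub>v z) \<bullet> (transpose_mat (bar_mat q G) *\<^sub>v bar_vec q x)" by simp
    also have "\<dots> = z \<bullet> (G *\<^sub>v (transpose_mat (bar_mat q G) *\<^sub>v bar_vec q x))"
      using G x z by (intro transpose_vec_mult_scalar[of _ n N]) auto
    also have "G *\<^sub>v (transpose_mat (bar_mat q G) *\<^sub>v bar_vec q x) = ?H *\<^sub>v bar_vec q x"
      using G x by (intro assoc_mult_mat_vec[of _ n N _ n, symmetric]) auto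
    finally show ?thesis .
  qed
  \<comment> \<open>Nondegeneracy of the scalar product, tested on unit vectors.\<close>
  have zero: "(\<forall>z\<in>carrier_vec n. z \<bullet> w = 0) \<longleftrightarrow> w = 0\<^sub>v n" if w: "w \<in> carrier_vec n" for w :: "'a vec"
  proof
    assume *: "\<forall>z\<in>carrier_vec n. z \<bullet> w = 0"
    show "w = 0\<^sub>v n"
    proof (rule eq_vecI)
      fix i assume "i < dim_vec (0\<^sub>v n :: 'a vec)"
      hence i: "i < n" by simp
      have "w $ i = unit_vec n i \<bullet> w" using i w by simp
      also have "\<dots> = 0" using * by simp
      finally show "w $ i = 0\<^sub>v n $ i" using i by simp
    qed (use w in simp)
  qed auto
  have "transpose_mat G *\<^sub>v x \<in> hermitian_dual q N (code_of G) \<longleftrightarrow> ?H *\<^sub>v bar_vec q x = 0\<^sub>v n"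
    if x: "x \<in> carrier_vec n" for x
  proof -
    have "transpose_mat G *\<^sub>v x \<in> hermitian_dual q N (code_of G) \<longleftrightarrow>
        (\<forall>z\<in>carrier_vec n. z \<bullet> (?H *\<^sub>v bar_vec q x) = 0)"
      using G x inner by (auto simp: hermitian_dual_def code_of_eq_image[OF G])
    also have "\<dots> \<longleftrightarrow> ?H *\<^sub>v bar_vec q x = 0\<^sub>v n"
      by (rule zero) (use G x in auto)
    finally show ?thesis .
  qed
  thus ?thesis by (auto simp: hermitian_hull_def code_of_eq_image[OF G])
qed

section \<open>Dimensions of the code and of its hull\<close>

lemma gen_mat_transpose_inj:
  assumes t: "t \<ge> 1" and x: "x \<in> carrier_vec n"
    and zero: "transpose_mat (gen_mat n t f A) *\<^sub>v x = 0\<^sub>v (t * n)"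
  shows "x = 0\<^sub>v n"
proof (rule eq_vecI)
  fix l assume "l < dim_vec (0\<^sub>v n :: 'a vec)"
  hence l: "l < n" by simp
  have lt: "l < t * n" using l t by (metis le_trans less_le_trans mult_1 mult_le_mono1)
  have "0 = (transpose_mat (gen_mat n t f A) *\<^sub>v x) $ l" using zero lt by simp
  also have "\<dots> = (\<Sum>i<n. gen_mat n t f A $$ (i, l) * x $ i)"
    using lt x gen_mat_carrier[OF t, of n f A] by (simp add: scalar_prod_def atLeast0LessThan)
  \<comment> \<open>Column \<open>l < n\<close> belongs to the identity block, so the first
    \<open>n\<close> coordinates of the product reproduce \<open>x\<close>.\<close>
  also have "\<dots> = (\<Sum>i<n. if i = l then x $ i else 0)"
    using l lt t by (intro sum.cong refl) (auto simp: gen_mat_def block_row_def)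
  also have "\<dots> = x $ l" using l by simp
  finally show "x $ l = 0\<^sub>v n $ l" using l by simp
qed (use x in simp)

text \<open>The line is the image of the one-column matrix with column \<open>h\<close>, which is
  injective as \<open>h\<close> is nonzero.\<close>

lemma linear_code_line:
  assumes h: "h \<in> carrier_vec N" "h \<noteq> 0\<^sub>v N"
  shows "linear_code N 1 (range (\<lambda>c. c \<cdot>\<^sub>v h))"
proof -
  define H where "H = mat_of_cols N [h]"
  have H: "H \<in> carrier_mat N 1" using mat_of_cols_carrier(1)[of N "[h]"] by (simp add: H_def)
  have Hx: "H *\<^sub>v x = x $ 0 \<cdot>\<^sub>v h" if "x \<in> carrier_vec 1" for x
    by (rule eq_vecI)
      (use that h in \<open>auto simp: H_def mat_of_cols_def scalar_prod_def mult.commute\<close>)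
  obtain i where i: "i < N" "h $ i \<noteq> 0" using h by (auto simp: vec_eq_iff)
  have "x = 0\<^sub>v 1" if x: "x \<in> carrier_vec 1" "H *\<^sub>v x = 0\<^sub>v N" for x
  proof -
    have "(x $ 0 \<cdot>\<^sub>v h) $ i = 0" unfolding Hx[OF x(1), symmetric] x(2) using i by simp
    hence "x $ 0 = 0" using i h by simp
    thus ?thesis using x(1) by (auto simp: vec_eq_iff)
  qed
  hence "linear_code N 1 ((\<lambda>x. H *\<^sub>v x) ` carrier_vec 1)" by (rule linear_code_image[OF H])
  moreover have "(\<lambda>x. H *\<^sub>v x) ` carrier_vec 1 = range (\<lambda>c. c \<cdot>\<^sub>v h)"
  proof safe
    fix c show "c \<cdot>\<^sub>v h \<in> (\<lambda>x. H *\<^sub>v x) ` carrier_vec 1"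
      by (rule image_eqI[of _ _ "vec 1 (\<lambda>_. c)"]) (auto simp: Hx)
  qed (use Hx in blast)
  ultimately show ?thesis by simp
qed

text \<open>Connects the polynomial of the Gram matrix with the condition imposed on the
  eigenvalues.\<close>

lemma poly_ac_1_plus_sum_squares:
  "poly_ac (1 + (\<Sum>k\<in>S. (f k)\<^sup>2)) x = 1 + (\<Sum>k\<in>S. (poly_ac (f k) x)\<^sup>2)"
proof -
  interpret h: field_hom "to_ac :: 'a :: field \<Rightarrow> 'a alg_closure" by (rule to_ac_hom)
  interpret m: map_poly_idom_hom "to_ac :: 'a \<Rightarrow> 'a alg_closure" ..
  show ?thesis
    by (simp add: poly_ac_def m.hom_add m.hom_sum m.hom_power poly_sum)
qed

text \<open>The core common to both characteristics: the condition says that the polynomial of the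
  Gram matrix vanishes at exactly one listed eigenvalue.\<close>

lemma gen_mat_code_one_dim_hull:
  fixes A :: "'a :: finite_field mat"
  assumes q: "primepow q" "CARD('a) = q\<^sup>2" and t: "t \<ge> 1"
    and A: "A \<in> carrier_mat n n" and herm: "hermitian_mat q A"
    and lam: "eigenvalues_listed n A lam"
    and coeffs: "\<And>k i. k \<in> {1..t-1} \<Longrightarrow> Polynomial.coeff (f k) i \<in> Fq q"
    and C: "C = code_of (gen_mat n t f A)"
    and uniq: "\<exists>!i. i \<in> {1..n} \<and> 1 + (\<Sum>k=1..t-1. (poly_ac (f k) (lam i))\<^sup>2) = 0"
  shows "linear_code (t * n) n C \<and> linear_code (t * n) 1 (hermitian_hull q (t * n) C)"
proof
  define G where "G = gen_mat n t f A"
  define p where "p = 1 + (\<Sum>k=1..t-1. (f k)\<^sup>2)"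
  have G: "G \<in> carrier_mat n (t * n)" unfolding G_def by (rule gen_mat_carrier[OF t])
  have GT: "transpose_mat G \<in> carrier_mat (t * n) n" using G by simp
  have gram: "G * transpose_mat (bar_mat q G) = mat_poly p A"
    unfolding G_def p_def by (rule gen_mat_gram[OF q A herm t coeffs])
  have inj: "x = 0\<^sub>v n" if "x \<in> carrier_vec n" "transpose_mat G *\<^sub>v x = 0\<^sub>v (t * n)" for x
    using gen_mat_transpose_inj[OF t] that by (simp add: G_def)
  show "linear_code (t * n) n C"
    unfolding C G_def[symmetric] code_of_eq_image[OF G] by (rule linear_code_image[OF GT inj])
  have "\<exists>!i. i \<in> {1..n} \<and> poly_ac p (lam i) = 0"
    using uniq by (simp add: p_def poly_ac_1_plus_sum_squares)
  then obtain u where u: "u \<in> carrier_vec n" "u \<noteq> 0\<^sub>v n" "mat_poly p A *\<^sub>v u = 0\<^sub>v n"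
    and line: "\<And>v. v \<in> carrier_vec n \<Longrightarrow> mat_poly p A *\<^sub>v v = 0\<^sub>v n \<Longrightarrow> \<exists>c. v = c \<cdot>\<^sub>v u"
    by (rule unique_listed_root_kernel_line[OF A lam]) blast
  \<comment> \<open>The kernel condition concerns the conjugate of the coefficient vector, so the
    codeword spanning the hull comes from the conjugate of \<open>u\<close>.\<close>
  define h where "h = transpose_mat G *\<^sub>v bar_vec q u"
  have bu: "bar_vec q u \<in> carrier_vec n" using u by simp
  have bb: "bar_vec q (bar_vec q v) = v" for v :: "'a vec" by (rule bar_vec_bar_vec[OF q(2)])
  have "bar_vec q u \<noteq> 0\<^sub>v n"
  proof
    assume *: "bar_vec q u = 0\<^sub>v n"
    have "q > 0" using q(1) by (simp add: primepow_gt_0_nat)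
    hence "bar_vec q (0\<^sub>v n :: 'a vec) = 0\<^sub>v n" by (intro eq_vecI) (auto simp: bar_vec_def)
    thus False using u(2) bb[of u] * by simp
  qed
  hence h: "h \<in> carrier_vec (t * n)" "h \<noteq> 0\<^sub>v (t * n)"
    using inj[OF bu] GT bu by (auto simp: h_def)
  \<comment> \<open>Conjugation is semilinear and an involution, so it carries the line of
    \<open>u\<close> onto the line of its conjugate, with \<open>c\<close> becoming
    \<open>c ^ q\<close>.\<close>
  have "{x \<in> carrier_vec n. mat_poly p A *\<^sub>v bar_vec q x = 0\<^sub>v n} = range (\<lambda>c. c \<cdot>\<^sub>v bar_vec q u)"
  proof safe
    fix x assume "x \<in> carrier_vec n" "mat_poly p A *\<^sub>v bar_vec q x = 0\<^sub>v n"
    then obtain c where "bar_vec q x = c \<cdot>\<^sub>v u" using line[of "bar_vec q x"] by auto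
    hence "x = c ^ q \<cdot>\<^sub>v bar_vec q u" using bb[of x] by (simp add: bar_vec_smult)
    thus "x \<in> range (\<lambda>c. c \<cdot>\<^sub>v bar_vec q u)" by blast
  next
    fix c
    show "mat_poly p A *\<^sub>v bar_vec q (c \<cdot>\<^sub>v bar_vec q u) = 0\<^sub>v n"
      using u A by (auto simp: bar_vec_smult bb mult_mat_vec[of _ n n])
  qed (use u in auto)
  hence "hermitian_hull q (t * n) C = (\<lambda>x. transpose_mat G *\<^sub>v x) ` (range (\<lambda>c. c \<cdot>\<^sub>v bar_vec q u))"
    unfolding C G_def[symmetric] hermitian_hull_code_of[OF q G] gram by simp
  also have "\<dots> = range (\<lambda>c. c \<cdot>\<^sub>v h)"
  proof -
    have "transpose_mat G *\<^sub>v (c \<cdot>\<^sub>v bar_vec q u) = c \<cdot>\<^sub>v h" for c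
      unfolding h_def by (rule mult_mat_vec[OF GT bu])
    thus ?thesis by (simp add: image_image)
  qed
  finally show "linear_code (t * n) 1 (hermitian_hull q (t * n) C)"
    using linear_code_line[OF h] by simp
qed

theorem theorem3p7:
  fixes q n t :: nat
    and A :: "'a :: finite_field mat"
    and lam :: "nat \<Rightarrow> 'a alg_closure"
    and f :: "nat \<Rightarrow> 'a poly"
    and C :: "'a vec set"
  assumes "primepow q" and "CARD('a) = q\<^sup>2"
    and "n \<ge> 1" and "t \<ge> 2"
    and "A \<in> carrier_mat n n" and "hermitian_mat q A"
    and "eigenvalues_listed n A lam"
    and "\<And>k i. k \<in> {1..t-1} \<Longrightarrow> Polynomial.coeff (f k) i \<in> Fq q"
    and "C = code_of (gen_mat n t f A)"
  shows
    "(even CHAR('a) \<longrightarrow>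
        (\<exists>!i. i \<in> {1..n} \<and> (\<Sum>k=1..t-1. poly_ac (f k) (lam i)) = 1) \<longrightarrow>
        linear_code (t * n) n C \<and> linear_code (t * n) 1 (hermitian_hull q (t * n) C))
     \<and>
     (odd CHAR('a) \<longrightarrow>
        ((\<exists>!i. i \<in> {1..n} \<and> (\<Sum>k=1..t-1. (poly_ac (f k) (lam i))\<^sup>2) = - 1) \<longrightarrow>
           linear_code (t * n) n C \<and> linear_code (t * n) 1 (hermitian_hull q (t * n) C))
        \<and>
        (t = 2 \<longrightarrow>
           (\<forall>\<mu> :: 'a. \<mu>\<^sup>2 = - 1 \<longrightarrow>
              (\<exists>!i. i \<in> {1..n} \<and> poly_ac (f 1) (lam i) \<in> {to_ac \<mu>, - to_ac \<mu>}) \<longrightarrow>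
              linear_code (2 * n) n C \<and> linear_code (2 * n) 1 (hermitian_hull q (2 * n) C))))"
proof -
  let ?goal = "linear_code (t * n) n C \<and> linear_code (t * n) 1 (hermitian_hull q (t * n) C)"
  have "t \<ge> 1" using assms(4) by simp
  from gen_mat_code_one_dim_hull[OF assms(1,2) this assms(5-9)]
  have core: ?goal if "\<exists>!i. i \<in> {1..n} \<and> (\<Sum>k=1..t-1. (poly_ac (f k) (lam i))\<^sup>2) = - 1"
    using that by (simp add: eq_neg_iff_add_eq_0 add.commute)
  \<comment> \<open>In characteristic two squaring is additive, so the sum of squares is the square
    of the sum; moreover \<open>- 1 = 1\<close>, and \<open>1\<close> is its only square root. The
    equivalence holds at each \<open>x\<close>, so unique existence carries over.\<close>
  have even_case: "(\<Sum>k=1..t-1. (poly_ac (f k) x)\<^sup>2) = - 1 \<longleftrightarrow> (\<Sum>k=1..t-1. poly_ac (f k) x) = 1"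
    if "even CHAR('a)" for x
  proof -
    have "Factorial_Ring.prime CHAR('a)" by (rule prime_CHAR_semidom) simp
    hence "CHAR('a) = 2" using that by (metis primes_dvd_imp_eq two_is_prime_nat)
    hence char: "CHAR('a alg_closure) = 2" by simp
    hence "of_nat 2 = (0 :: 'a alg_closure)" using of_nat_CHAR[where ?'a = "'a alg_closure"] by simp
    hence two: "(2 :: 'a alg_closure) = 0" by simp
    have sq: "(\<Sum>k=1..t-1. (poly_ac (f k) x)\<^sup>2) = (\<Sum>k=1..t-1. poly_ac (f k) x)\<^sup>2"
      using freshmans_dream_sum[where ?'a = "'a alg_closure" and n = 2] char
      by (metis two_is_prime_nat)
    have minus_one: "- 1 = (1 :: 'a alg_closure)"
      using two by (metis neg_eq_iff_add_eq_0 one_add_one)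
    show ?thesis unfolding sq minus_one power2_eq_1_iff by simp
  qed
  \<comment> \<open>The sum has a single term, and its square equals \<open>- 1\<close>, the square
    of \<open>to_ac \<mu>\<close>, exactly when the term is \<open>to_ac \<mu>\<close> up to
    sign.\<close>
  have t2_case: "(\<Sum>k=1..t-1. (poly_ac (f k) x)\<^sup>2) = - 1 \<longleftrightarrow> poly_ac (f 1) x \<in> {to_ac \<mu>, - to_ac \<mu>}"
    if "t = 2" "\<mu>\<^sup>2 = - 1" for x and \<mu> :: 'a
  proof -
    have "(to_ac \<mu>)\<^sup>2 = - 1" using that(2) by (metis to_ac_1 to_ac_minus to_ac_power)
    hence "(poly_ac (f 1) x)\<^sup>2 = - 1 \<longleftrightarrow> (poly_ac (f 1) x)\<^sup>2 = (to_ac \<mu>)\<^sup>2" by simp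
    thus ?thesis using that(1) by (simp add: power2_eq_iff)
  qed
  have "?goal" if "even CHAR('a)"
    "\<exists>!i. i \<in> {1..n} \<and> (\<Sum>k=1..t-1. poly_ac (f k) (lam i)) = 1"
    using that(2) by (intro core) (simp only: even_case[OF that(1)])
  moreover have "linear_code (2 * n) n C \<and> linear_code (2 * n) 1 (hermitian_hull q (2 * n) C)"
    if "t = 2" "\<mu>\<^sup>2 = - 1"
      "\<exists>!i. i \<in> {1..n} \<and> poly_ac (f 1) (lam i) \<in> {to_ac \<mu>, - to_ac \<mu>}" for \<mu>
    using core[unfolded t2_case[OF that(1,2)], OF that(3)] unfolding that(1) .
  ultimately show ?thesis using core by blast
qed

end
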